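(* Let $A$, $B$, $T>0$ and the operators $W^T$, $W_\#^T$, $C^T$ be as in the context. Assume: (a) the spectrum of $A$ is simple, i.e. it consists of (infinitely many) eigenvalues with algebraic multiplicity one, denoted $\{\lambda_k\}_{k=1}^\infty$, and the adjoint operator $A^*$ has spectrum $\{\overline{\lambda_k}\}_{k=1}^\infty$; (b) the eigenfunctions $\{\varphi_k\}_{k=1}^\infty$ of $A$ form a Riesz basis in $H$, the basis of eigenfunctions of $A^*$ is denoted $\{\psi_k\}_{k=1}^\infty$, and $(\varphi_k,\psi_l)_H=\delta_{kl}$; (c) both control systems of the context are spectrally controllable, i.e. there exist controls $f_k,g_k\in H_0^1((0,T);Y)$ such that $W^Tf_k=\varphi_k$ and $W_\#^Tg_k=\psi_k$. Then the spectrum of $A$ and the (non-normalized) controls $f_k$ are the spectrum and the eigenvectors of the generalized spectral problem $$C^T\dot f_k+i\lambda_kC^Tf_k=0,$$ where the dot denotes differentiation with respect to $t$.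
   Context: $H$ and $Y$ are Hilbert spaces, $A$ is an operator in $H$, not necessarily self-adjoint, with adjoint $A^*$, and $B:Y\to H$ is an input operator. $T>0$ is fixed and $\mathcal F^T=L^2((0,T);Y)$. For $f\in\mathcal F^T$, $u^f$ denotes the solution of $iu_t-Au=Bf$, $t>0$, $u(0)=0$; for $g\in\mathcal F^T$, $v^g$ denotes the solution of $iv_t+A^*v=-Bg$, $t>0$, $v(0)=0$. These are the two control systems. The control operators $W^T,W_\#^T:\mathcal F^T\to H$ are $W^Tf=u^f(T)$ and $W_\#^Tg=v^g(T)$. The connecting operator $C^T:\mathcal F^T\to\mathcal F^T$ is defined by its form $(C^Tf,g)_{\mathcal F^T}=(u^f(T),v^g(T))_H=(W^Tf,W_\#^Tg)_H$.
   Formalization: Eigenvectors of the generalized spectral problem are taken to be f in H_0^1 with C^T f ≠ 0, not merely f ≠ 0; any nonzero f in H_0^1 with W^T f = 0 solves the equation for every λ, so the literal claim would fail. *)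

theory Defs
  imports "HOL-Analysis.Analysis"
begin

section \<open>Complex Hilbert spaces\<close>

class complex_vector = real_vector +
  fixes scaleC :: "complex \<Rightarrow> 'a \<Rightarrow> 'a"  (infixr "*\<^sub>C" 75)
  assumes scaleC_add_right: "a *\<^sub>C (x + y) = a *\<^sub>C x + a *\<^sub>C y"
    and scaleC_add_left: "(a + b) *\<^sub>C x = a *\<^sub>C x + b *\<^sub>C x"
    and scaleC_scaleC: "a *\<^sub>C b *\<^sub>C x = (a * b) *\<^sub>C x"
    and scaleC_one: "1 *\<^sub>C x = x"
    and scaleR_scaleC: "r *\<^sub>R x = complex_of_real r *\<^sub>C x"

text \<open>The inner product is linear in the first argument and antilinear in the second. Its
  positive definiteness is part of the norm axioms, through \<open>norm_eq_sqrt_cinner\<close>.\<close>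

class complex_inner = complex_vector + real_normed_vector +
  fixes cinner :: "'a \<Rightarrow> 'a \<Rightarrow> complex"
  assumes cinner_commute: "cinner x y = cnj (cinner y x)"
    and cinner_add_left: "cinner (x + y) z = cinner x z + cinner y z"
    and cinner_scaleC_left: "cinner (a *\<^sub>C x) y = a * cinner x y"
    and norm_eq_sqrt_cinner: "norm x = sqrt (Re (cinner x x))"

class chilbert_space = complex_inner + banach

global_interpretation complex_vector:
  vector_space "scaleC :: complex \<Rightarrow> 'a \<Rightarrow> 'a :: complex_vector"
  by unfold_locales (simp_all add: scaleC_add_right scaleC_add_left scaleC_scaleC scaleC_one)

definition bounded_clinear :: "('a::complex_inner \<Rightarrow> 'b::complex_inner) \<Rightarrow> bool" where
  "bounded_clinear F \<longleftrightarrow> bounded_linear F \<and> (\<forall>c x. F (c *\<^sub>C x) = c *\<^sub>C F x)"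

definition orthonormal_basis :: "(nat \<Rightarrow> 'h::chilbert_space) \<Rightarrow> bool" where
  "orthonormal_basis e \<longleftrightarrow>
     (\<forall>j k. cinner (e j) (e k) = (if j = k then 1 else 0)) \<and>
     closure (complex_vector.span (range e)) = UNIV"

definition riesz_basis :: "(nat \<Rightarrow> 'h::chilbert_space) \<Rightarrow> bool" where
  "riesz_basis \<phi> \<longleftrightarrow>
     (\<exists>(e :: nat \<Rightarrow> 'h) (V :: 'h \<Rightarrow> 'h).
        orthonormal_basis e \<and> bounded_clinear V \<and> bij V \<and> bounded_clinear (inv V) \<and>
        (\<forall>k. \<phi> k = V (e k)))"


section \<open>Unbounded operators\<close>

text \<open>An operator in \<open>H\<close> is a pair of a domain \<open>D\<close> and a function \<open>A\<close>; the values of \<open>A\<close>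
  outside \<open>D\<close> are irrelevant.\<close>

definition densely_defined_operator ::
    "'h::chilbert_space set \<Rightarrow> ('h \<Rightarrow> 'h) \<Rightarrow> bool" where
  "densely_defined_operator D A \<longleftrightarrow>
     complex_vector.subspace D \<and> closure D = UNIV \<and>
     (\<forall>x\<in>D. \<forall>y\<in>D. A (x + y) = A x + A y) \<and> (\<forall>c. \<forall>x\<in>D. A (c *\<^sub>C x) = c *\<^sub>C A x)"

definition adj_dom :: "'h::chilbert_space set \<Rightarrow> ('h \<Rightarrow> 'h) \<Rightarrow> 'h set" where
  "adj_dom D A = {w. \<exists>z. \<forall>x\<in>D. cinner (A x) w = cinner x z}"

definition adj_op :: "'h::chilbert_space set \<Rightarrow> ('h \<Rightarrow> 'h) \<Rightarrow> 'h \<Rightarrow> 'h" where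
  "adj_op D A w = (THE z. \<forall>x\<in>D. cinner (A x) w = cinner x z)"

definition op_spectrum :: "'h::chilbert_space set \<Rightarrow> ('h \<Rightarrow> 'h) \<Rightarrow> complex set" where
  "op_spectrum D A = - {\<mu>. \<exists>R. bounded_clinear R \<and>
      (\<forall>y. R y \<in> D \<and> A (R y) - \<mu> *\<^sub>C R y = y) \<and> (\<forall>x\<in>D. R (A x - \<mu> *\<^sub>C x) = x)}"

definition eigenvector :: "'h::chilbert_space set \<Rightarrow> ('h \<Rightarrow> 'h) \<Rightarrow> complex \<Rightarrow> 'h \<Rightarrow> bool" where
  "eigenvector D A \<mu> x \<longleftrightarrow> x \<in> D \<and> x \<noteq> 0 \<and> A x = \<mu> *\<^sub>C x"

primrec ker_pow :: "'h::chilbert_space set \<Rightarrow> ('h \<Rightarrow> 'h) \<Rightarrow> complex \<Rightarrow> nat \<Rightarrow> 'h set" where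
  "ker_pow D A \<mu> 0 = {0}"
| "ker_pow D A \<mu> (Suc n) = {x \<in> D. A x - \<mu> *\<^sub>C x \<in> ker_pow D A \<mu> n}"

text \<open>The dimension of the root subspace \<open>\<Union>\<^sub>n ker (A - \<mu>)\<^sup>n\<close>; as usual for
  \<open>complex_vector.dim\<close>, the value is 0 if that dimension is infinite.\<close>

definition alg_multiplicity :: "'h::chilbert_space set \<Rightarrow> ('h \<Rightarrow> 'h) \<Rightarrow> complex \<Rightarrow> nat" where
  "alg_multiplicity D A \<mu> = complex_vector.dim (\<Union>n. ker_pow D A \<mu> n)"


section \<open>Control functions\<close>

text \<open>Elements of \<open>L\<^sup>2((0,T);Y)\<close> are represented by functions, and equality in that space is
  equality almost everywhere on \<open>[0,T]\<close>. The predicate \<open>measurable_on\<close> (almost everywhere limit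
  of continuous functions) is strong measurability, also if \<open>Y\<close> is not separable.\<close>

definition L2 :: "real \<Rightarrow> (real \<Rightarrow> 'y::chilbert_space) set" where
  "L2 T = {f. f measurable_on {0..T} \<and> (\<lambda>t. (norm (f t))\<^sup>2) absolutely_integrable_on {0..T}}"

definition L2_inner :: "real \<Rightarrow> (real \<Rightarrow> 'y::chilbert_space) \<Rightarrow> (real \<Rightarrow> 'y) \<Rightarrow> complex" where
  "L2_inner T f g = integral {0..T} (\<lambda>t. cinner (f t) (g t))"

definition AE_zero :: "real \<Rightarrow> (real \<Rightarrow> 'y::chilbert_space) \<Rightarrow> bool" where
  "AE_zero T f \<longleftrightarrow> (AE t in lebesgue_on {0..T}. f t = 0)"

text \<open>\<open>H\<^sub>0\<^sup>1((0,T);Y)\<close>, each class being represented by its absolutely continuous member: the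
  primitives \<open>f(t) = \<integral>\<^sub>0\<^sup>t f'\<close> of functions \<open>f' \<in> L\<^sup>2\<close> with \<open>f(T) = 0\<close>. The integral \<open>has_integral\<close> agrees with Bochner's integral on \<open>L\<^sup>2\<close> and does not
  require \<open>Y\<close> to be separable.\<close>

definition has_L2_derivative ::
    "real \<Rightarrow> (real \<Rightarrow> 'y::chilbert_space) \<Rightarrow> (real \<Rightarrow> 'y) \<Rightarrow> bool" where
  "has_L2_derivative T f f' \<longleftrightarrow>
     f' \<in> L2 T \<and> (\<forall>t\<in>{0..T}. (f' has_integral (f t - f 0)) {0..t})"

definition H10 :: "real \<Rightarrow> (real \<Rightarrow> 'y::chilbert_space) set" where
  "H10 T = {f \<in> L2 T. f 0 = 0 \<and> f T = 0 \<and> (\<exists>f'. has_L2_derivative T f f')}"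

definition tderiv :: "real \<Rightarrow> (real \<Rightarrow> 'y::chilbert_space) \<Rightarrow> real \<Rightarrow> 'y" where
  "tderiv T f = (SOME f'. has_L2_derivative T f f')"


section \<open>The control systems\<close>

text \<open>Weak solutions on \<open>[0,T]\<close> of \<open>i u\<^sub>t - A u = B f\<close>, \<open>u(0) = 0\<close>: for every \<open>w\<close> in the domain
  of \<open>A\<^sup>*\<close>, the equation \<open>i d/dt (u,w) = (u, A\<^sup>* w) + (B f, w)\<close> in integrated form.\<close>

definition weak_solution ::
    "'h::chilbert_space set \<Rightarrow> ('h \<Rightarrow> 'h) \<Rightarrow> ('y::chilbert_space \<Rightarrow> 'h) \<Rightarrow> real \<Rightarrow>
     (real \<Rightarrow> 'y) \<Rightarrow> (real \<Rightarrow> 'h) \<Rightarrow> bool" where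
  "weak_solution D A B T f u \<longleftrightarrow>
     continuous_on {0..T} u \<and> u 0 = 0 \<and>
     (\<forall>w\<in>adj_dom D A. \<forall>t\<in>{0..T}.
        ((\<lambda>s. cinner (u s) (adj_op D A w) + cinner (B (f s)) w)
           has_integral (\<i> * cinner (u t) w)) {0..t})"

definition well_posed ::
    "'h::chilbert_space set \<Rightarrow> ('h \<Rightarrow> 'h) \<Rightarrow> ('y::chilbert_space \<Rightarrow> 'h) \<Rightarrow> real \<Rightarrow> bool" where
  "well_posed D A B T \<longleftrightarrow>
     (\<forall>f\<in>L2 T. (\<exists>u. weak_solution D A B T f u) \<and>
        (\<forall>u v. weak_solution D A B T f u \<longrightarrow> weak_solution D A B T f v \<longrightarrow>
               (\<forall>t\<in>{0..T}. u t = v t)))"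

definition control_op ::
    "'h::chilbert_space set \<Rightarrow> ('h \<Rightarrow> 'h) \<Rightarrow> ('y::chilbert_space \<Rightarrow> 'h) \<Rightarrow> real \<Rightarrow>
     (real \<Rightarrow> 'y) \<Rightarrow> 'h" where
  "control_op D A B T f = (SOME u. weak_solution D A B T f u) T"

text \<open>The second system \<open>i v\<^sub>t + A\<^sup>* v = - B g\<close> is the first one with \<open>- A\<^sup>*\<close> and \<open>- B\<close> in place
  of \<open>A\<close> and \<open>B\<close>.\<close>

definition dual_well_posed ::
    "'h::chilbert_space set \<Rightarrow> ('h \<Rightarrow> 'h) \<Rightarrow> ('y::chilbert_space \<Rightarrow> 'h) \<Rightarrow> real \<Rightarrow> bool" where
  "dual_well_posed D A B T \<longleftrightarrow>
     well_posed (adj_dom D A) (\<lambda>x. - adj_op D A x) (\<lambda>y. - B y) T"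

definition dual_control_op ::
    "'h::chilbert_space set \<Rightarrow> ('h \<Rightarrow> 'h) \<Rightarrow> ('y::chilbert_space \<Rightarrow> 'h) \<Rightarrow> real \<Rightarrow>
     (real \<Rightarrow> 'y) \<Rightarrow> 'h" where
  "dual_control_op D A B T = control_op (adj_dom D A) (\<lambda>x. - adj_op D A x) (\<lambda>y. - B y) T"

text \<open>This determines \<open>C f\<close> up to equality almost everywhere.\<close>

definition connecting_operator ::
    "'h::chilbert_space set \<Rightarrow> ('h \<Rightarrow> 'h) \<Rightarrow> ('y::chilbert_space \<Rightarrow> 'h) \<Rightarrow> real \<Rightarrow>
     ((real \<Rightarrow> 'y) \<Rightarrow> (real \<Rightarrow> 'y)) \<Rightarrow> bool" where
  "connecting_operator D A B T C \<longleftrightarrow>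
     (\<forall>f\<in>L2 T. C f \<in> L2 T \<and>
        (\<forall>g\<in>L2 T. L2_inner T (C f) g = cinner (control_op D A B T f) (dual_control_op D A B T g)))"


section \<open>The generalized spectral problem\<close>

text \<open>Eigenvectors are nonzero modulo the kernel of \<open>C\<close>: if a control \<open>f \<in> H\<^sub>0\<^sup>1\<close> steers the
  system to 0 then \<open>C f = 0\<close> and \<open>C f' = 0\<close>, so that \<open>f\<close> satisfies the equation for every
  \<open>\<mu>\<close>.\<close>

definition gen_eigenvector ::
    "((real \<Rightarrow> 'y::chilbert_space) \<Rightarrow> (real \<Rightarrow> 'y)) \<Rightarrow> real \<Rightarrow> complex \<Rightarrow> (real \<Rightarrow> 'y) \<Rightarrow> bool" where
  "gen_eigenvector C T \<mu> f \<longleftrightarrow>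
     f \<in> H10 T \<and> \<not> AE_zero T (C f) \<and>
     AE_zero T (\<lambda>t. C (tderiv T f) t + (\<i> * \<mu>) *\<^sub>C C f t)"

definition gen_spectrum ::
    "((real \<Rightarrow> 'y::chilbert_space) \<Rightarrow> (real \<Rightarrow> 'y)) \<Rightarrow> real \<Rightarrow> complex set" where
  "gen_spectrum C T = {\<mu>. \<exists>f. gen_eigenvector C T \<mu> f}"

end

theory Submission
  imports Defs
begin

text \<open>For a control \<open>h\<close> vanishing at both ends, differentiating the system in time gives
  \<open>W h' = - \<i> A (W h)\<close>. Tested against the eigenvectors \<open>\<psi> l\<close> of the adjoint this is the scalar identity
  \<open>(W h', \<psi> l) = - \<i> \<lambda>\<^sub>l (W h, \<psi> l)\<close>. As the \<open>\<psi> l\<close> are reachable for the dual system, the equation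
  \<open>C h' + \<i> \<mu> C h = 0\<close> is equivalent to \<open>(\<mu> - \<lambda>\<^sub>l) (W h, \<psi> l) = 0\<close> for all \<open>l\<close>. By totality and
  biorthogonality, a control with \<open>W h \<noteq> 0\<close> satisfies this iff \<open>\<mu> = \<lambda>\<^sub>k\<close> and \<open>W h\<close> is a multiple of
  \<open>\<phi> k\<close>, for some \<open>k\<close>.\<close>

section \<open>Complex inner products\<close>

lemma cinner_add_right: "cinner x (y + z) = cinner x y + cinner x (z :: 'a::complex_inner)"
  by (metis cinner_add_left cinner_commute complex_cnj_add)

lemma cinner_scaleC_right: "cinner x (a *\<^sub>C y) = cnj a * cinner x (y :: 'a::complex_inner)"
  by (metis cinner_commute cinner_scaleC_left complex_cnj_mult)

lemma cinner_zero_left [simp]: "cinner 0 (y :: 'a::complex_inner) = 0"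
  using cinner_add_left [of 0 0 y] by simp

lemma cinner_zero_right [simp]: "cinner (x :: 'a::complex_inner) 0 = 0"
  using cinner_add_right [of x 0 0] by simp

lemma cinner_diff_left: "cinner (x - y) z = cinner x z - cinner y (z :: 'a::complex_inner)"
  using cinner_add_left [of "x - y" y z] by simp

lemma cinner_self: "cinner x x = complex_of_real ((norm (x :: 'a::complex_inner))\<^sup>2)"
proof -
  have "Im (cinner x x) = 0"
    using arg_cong [OF cinner_commute [of x x], of Im] by simp
  \<comment> \<open>\<open>sqrt\<close> in HOL is odd, so the nonnegativity of the norm is what
    excludes a negative real part.\<close>
  moreover have "(norm x)\<^sup>2 = Re (cinner x x)"
    using norm_ge_zero [of x] unfolding norm_eq_sqrt_cinner by simp
  ultimately show ?thesis
    by (simp add: complex_eq_iff)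
qed

lemma cinner_self_eq_0_iff [simp]: "cinner x x = 0 \<longleftrightarrow> x = (0 :: 'a::complex_inner)"
  by (simp add: cinner_self)

lemma norm_scaleC: "norm (a *\<^sub>C x) = cmod a * norm (x :: 'a::complex_inner)"
proof -
  have "complex_of_real ((norm (a *\<^sub>C x))\<^sup>2) = complex_of_real ((cmod a * norm x)\<^sup>2)"
    unfolding cinner_self [symmetric] cinner_scaleC_left cinner_scaleC_right power_mult_distrib
      of_real_mult complex_norm_square
    by (simp add: cinner_self ac_simps)
  then show ?thesis
    by (simp only: of_real_eq_iff) (simp add: power2_eq_iff_nonneg)
qed

lemma norm_cinner_le: "cmod (cinner x y) \<le> norm x * norm (y :: 'a::complex_inner)"
proof (cases "y = 0")
  case False
  define c where "c = cinner x y"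
  define n where "n = (norm y)\<^sup>2"
  have n: "n > 0"
    using False by (simp add: n_def)
  \<comment> \<open>Up to the factor \<open>n\<close>, this is the component of \<open>x\<close>
    orthogonal to \<open>y\<close>; the scaling avoids division. The inequality to be shown is the
    nonnegativity of \<open>cinner z z\<close>.\<close>
  define z where "z = complex_of_real n *\<^sub>C x - c *\<^sub>C y"
  have zy: "cinner z y = 0"
    by (simp add: z_def cinner_diff_left cinner_scaleC_left cinner_self n_def c_def)
  have "cinner z z = cinner z (complex_of_real n *\<^sub>C x)"
    using cinner_add_right [of z z "c *\<^sub>C y"] zy by (simp add: cinner_scaleC_right) (simp add: z_def cinner_scaleC_right)
  also have "\<dots> = complex_of_real n * (complex_of_real n * complex_of_real ((norm x)\<^sup>2) - c * cnj c)"
    using cinner_commute [of y x]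
    by (simp add: cinner_scaleC_right z_def cinner_diff_left cinner_scaleC_left cinner_self c_def)
  also have "\<dots> = complex_of_real (n * (n * (norm x)\<^sup>2 - (cmod c)\<^sup>2))"
    unfolding complex_norm_square [symmetric] by simp
  finally have "0 \<le> n * (n * (norm x)\<^sup>2 - (cmod c)\<^sup>2)"
    unfolding cinner_self of_real_eq_iff by (metis zero_le_power2)
  then have "(cmod c)\<^sup>2 \<le> (norm x * norm y)\<^sup>2"
    using n by (simp add: zero_le_mult_iff n_def power_mult_distrib mult.commute)
  then show ?thesis
    unfolding c_def by (rule power2_le_imp_le) simp
qed simp

lemma bounded_bilinear_cinner: "bounded_bilinear (cinner :: 'a::complex_inner \<Rightarrow> 'a \<Rightarrow> complex)"
proof
  show "\<exists>K. \<forall>a b. cmod (cinner a b) \<le> norm a * norm (b :: 'a) * K"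
    by (intro exI [of _ 1]) (simp add: norm_cinner_le)
qed (simp_all add: cinner_add_left cinner_add_right scaleR_scaleC cinner_scaleC_left
      cinner_scaleC_right, simp_all add: scaleR_conv_of_real)

lemma bounded_linear_scaleC: "bounded_linear (\<lambda>x :: 'a::complex_inner. c *\<^sub>C x)"
  by (rule bounded_linear_intro [where K = "cmod c"])
    (simp_all add: scaleC_add_right scaleR_scaleC scaleC_scaleC norm_scaleC mult.commute)

text \<open>The vectors \<open>y\<close> with \<open>V y\<close> orthogonal to \<open>x\<close> form
  a closed subspace containing the orthonormal basis \<open>e\<close>, hence the whole space.
  Surjectivity of \<open>V\<close> allows \<open>V y = x\<close>, so \<open>x\<close> is orthogonal
  to itself.\<close>

lemma riesz_basis_total:
  fixes x :: "'h::chilbert_space"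
  assumes "riesz_basis \<psi>" and "\<And>k. cinner x (\<psi> k) = 0"
  shows "x = 0"
proof -
  obtain e and V :: "'h \<Rightarrow> 'h" where e: "orthonormal_basis e" and V: "bounded_clinear V" and bij: "bij V"
    and \<psi>: "\<And>k. \<psi> k = V (e k)"
    using assms(1) unfolding riesz_basis_def by blast
  have lin: "bounded_linear V" and scale: "\<And>c y. V (c *\<^sub>C y) = c *\<^sub>C V y"
    using V by (auto simp: bounded_clinear_def)
  define Z where "Z = {y. cinner x (V y) = 0}"
  have "complex_vector.subspace Z"
    by (rule complex_vector.subspaceI)
      (simp_all add: Z_def cinner_add_right cinner_scaleC_right scale linear_simps(1) [OF lin]
        linear_simps(3) [OF lin])
  moreover have "range e \<subseteq> Z"
    using assms(2) by (auto simp: Z_def \<psi>)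
  ultimately have "complex_vector.span (range e) \<subseteq> Z"
    by (rule complex_vector.span_minimal [rotated])
  moreover have "closed Z"
    unfolding Z_def
    by (intro closed_Collect_eq continuous_on_const bounded_bilinear.continuous_on
        [OF bounded_bilinear_cinner] linear_continuous_on [OF lin])
  ultimately have "Z = UNIV"
    using e closure_minimal unfolding orthonormal_basis_def by blast
  moreover obtain y where "x = V y"
    using bij by (metis bij_pointE)
  ultimately have "cinner x x = 0"
    unfolding Z_def by blast
  then show ?thesis
    by simp
qed

section \<open>Square integrable functions\<close>

lemma L2_add:
  assumes "f \<in> L2 T" "g \<in> L2 T"
  shows "(\<lambda>t. f t + g t) \<in> L2 T"
proof -
  have m: "(\<lambda>t. f t + g t) measurable_on {0..T}"
    using assms by (auto simp: L2_def intro: measurable_on_add)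
  \<comment> \<open>\<open>measurable_on\<close> extends functions by 0 off the interval, so the
    continuous map applied here has to send 0 to 0.\<close>
  have "(\<lambda>t. (norm (f t + g t))\<^sup>2) measurable_on {0..T}"
    using measurable_on_compose_continuous_0 [OF m, of "\<lambda>y. (norm y)\<^sup>2"]
    by (simp add: o_def continuous_intros)
  then have "(\<lambda>t. (norm (f t + g t))\<^sup>2) \<in> borel_measurable (lebesgue_on {0..T})"
    by (simp add: measurable_on_iff_borel_measurable)
  moreover have "(\<lambda>t. 2 * (norm (f t))\<^sup>2 + 2 * (norm (g t))\<^sup>2) integrable_on {0..T}"
    using assms by (intro integrable_add integrable_on_mult_right)
      (auto simp: L2_def dest: set_lebesgue_integral_eq_integral(1))
  moreover have "norm ((norm (f t + g t))\<^sup>2) \<le> 2 * (norm (f t))\<^sup>2 + 2 * (norm (g t))\<^sup>2" for t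
  proof -
    have "(norm (f t + g t))\<^sup>2 \<le> (norm (f t) + norm (g t))\<^sup>2"
      by (intro power_mono norm_triangle_ineq) simp
    also have "\<dots> \<le> 2 * (norm (f t))\<^sup>2 + 2 * (norm (g t))\<^sup>2"
      using zero_le_power2 [of "norm (f t) - norm (g t)"] by (simp add: power2_eq_square algebra_simps)
    finally show ?thesis
      by simp
  qed
  ultimately have "(\<lambda>t. (norm (f t + g t))\<^sup>2) absolutely_integrable_on {0..T}"
    by (intro measurable_bounded_by_integrable_imp_absolutely_integrable) auto
  with m show ?thesis
    by (simp add: L2_def)
qed

lemma L2_scaleC:
  fixes f :: "real \<Rightarrow> 'y::chilbert_space"
  assumes "f \<in> L2 T"
  shows "(\<lambda>t. c *\<^sub>C f t) \<in> L2 T"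
proof -
  have "((*\<^sub>C) c \<circ> f) measurable_on {0..T}"
    using assms by (intro measurable_on_compose_continuous_0)
      (auto simp: L2_def intro: linear_continuous_on bounded_linear_scaleC)
  moreover have "(\<lambda>t. (cmod c)\<^sup>2 * (norm (f t))\<^sup>2) absolutely_integrable_on {0..T}"
    using assms by (intro set_integrable_mult_right) (simp add: L2_def)
  ultimately show ?thesis
    by (simp add: L2_def o_def norm_scaleC power_mult_distrib)
qed

text \<open>Cauchy-Schwarz dominates the integrand by the sum of the squared norms. This licenses
  splitting \<open>L2_inner\<close>, whose \<open>integral\<close> defaults to 0 on non-integrable
  functions.\<close>

lemma L2_cinner_integrable:
  fixes f g :: "real \<Rightarrow> 'a::chilbert_space"
  assumes "f \<in> L2 T" "g \<in> L2 T"
  shows "(\<lambda>t. cinner (f t) (g t)) integrable_on {0..T}"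
proof -
  have "(\<lambda>t. cinner (f t) (g t)) measurable_on {0..T}"
  proof (rule measurable_on_combine [where h = cinner])
    show "continuous_on UNIV (\<lambda>x :: 'a \<times> 'a. cinner (fst x) (snd x))"
      by (rule bounded_bilinear.continuous_on [OF bounded_bilinear_cinner continuous_on_fst
            continuous_on_snd, OF continuous_on_id continuous_on_id])
  qed (use assms in \<open>auto simp: L2_def\<close>)
  then have "(\<lambda>t. cinner (f t) (g t)) \<in> borel_measurable (lebesgue_on {0..T})"
    by (simp add: measurable_on_iff_borel_measurable)
  moreover have "(\<lambda>t. (norm (f t))\<^sup>2 + (norm (g t))\<^sup>2) integrable_on {0..T}"
    using assms by (intro integrable_add)
      (auto simp: L2_def dest: set_lebesgue_integral_eq_integral(1))
  moreover have "cmod (cinner (f t) (g t)) \<le> (norm (f t))\<^sup>2 + (norm (g t))\<^sup>2" for t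
  proof -
    have "norm (f t) * norm (g t) \<le> (norm (f t))\<^sup>2 + (norm (g t))\<^sup>2"
      using sum_squares_bound [of "norm (f t)" "norm (g t)"]
        mult_nonneg_nonneg [OF norm_ge_zero [of "f t"] norm_ge_zero [of "g t"]] by linarith
    then show ?thesis
      by (rule order_trans [OF norm_cinner_le])
  qed
  ultimately show ?thesis
    by (rule measurable_bounded_by_integrable_imp_integrable) simp_all
qed

lemma L2_inner_add_scaleC:
  assumes "f \<in> L2 T" "f' \<in> L2 T" "g \<in> L2 T"
  shows "L2_inner T (\<lambda>t. f t + c *\<^sub>C f' t) g = L2_inner T f g + c * L2_inner T f' g"
  unfolding L2_inner_def cinner_add_left cinner_scaleC_left
  using integral_add [OF L2_cinner_integrable [OF assms(1,3)]
      integrable_on_mult_right [OF L2_cinner_integrable [OF assms(2,3)], of c]]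
  by (simp only: integral_mult_right)

lemma L2_inner_AE_zero:
  assumes "AE_zero T f"
  shows "L2_inner T f g = 0"
proof -
  have "AE t in lebesgue. t \<in> {0..T} \<longrightarrow> f t = 0"
    using assms unfolding AE_zero_def by (subst (asm) AE_restrict_space_iff) auto
  then obtain N where N: "\<And>t. t \<in> space lebesgue - N \<Longrightarrow> t \<in> {0..T} \<longrightarrow> f t = 0"
      "N \<in> null_sets lebesgue"
    by (rule AE_E3) blast
  have "integral {0..T} (\<lambda>t. cinner (f t) (g t)) = integral {0..T} (\<lambda>t. 0)"
    using N by (intro integral_spike [of N]) (auto simp: negligible_iff_null_sets)
  then show ?thesis
    by (simp add: L2_inner_def)
qed

text \<open>The form at \<open>(f, f)\<close> is the integral of a nonnegative function, so it
  vanishes only if that function is 0 almost everywhere.\<close>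

lemma AE_zero_L2_inner_self:
  fixes f :: "real \<Rightarrow> 'y::chilbert_space"
  assumes "f \<in> L2 T" "L2_inner T f f = 0"
  shows "AE_zero T f"
proof -
  have int: "integrable (lebesgue_on {0..T}) (\<lambda>t. (norm (f t))\<^sup>2)"
    using assms(1) by (simp add: L2_def integrable_restrict_space set_integrable_def)
  have "((\<lambda>t. complex_of_real ((norm (f t))\<^sup>2)) has_integral
      complex_of_real (integral {0..T} (\<lambda>t. (norm (f t))\<^sup>2))) {0..T}"
    using assms(1) by (intro has_integral_of_real integrable_integral)
      (auto simp: L2_def dest: set_lebesgue_integral_eq_integral(1))
  from integral_unique [OF this] have "integral {0..T} (\<lambda>t. (norm (f t))\<^sup>2) = 0"
    using assms(2) unfolding L2_inner_def cinner_self by (metis of_real_eq_0_iff)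
  with int have "AE t in lebesgue_on {0..T}. (norm (f t))\<^sup>2 = 0"
    by (subst integral_nonneg_eq_0_iff_AE [symmetric]) (auto simp: lebesgue_integral_eq_integral)
  then show ?thesis
    by (simp add: AE_zero_def)
qed

lemma H10_tderiv:
  assumes "h \<in> H10 T"
  shows "has_L2_derivative T h (tderiv T h)"
proof -
  obtain h' where "has_L2_derivative T h h'"
    using assms by (auto simp: H10_def)
  then show ?thesis
    unfolding tderiv_def by (rule someI [of "has_L2_derivative T h"])
qed

section \<open>The control operator on derivatives\<close>

text \<open>A continuous solution is a multiple of the integral of a continuous function, hence
  differentiable, with d' = -i \<mu> d and d(0) = 0. Multiplied by the integrating factor exp(i
  \<mu> t) it becomes constant.\<close>

lemma homogeneous_volterra_unique:
  fixes d :: "real \<Rightarrow> complex"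
  assumes cont: "continuous_on {0..T} d"
    and eq: "\<And>t. t \<in> {0..T} \<Longrightarrow> ((\<lambda>s. \<mu> * d s) has_integral (\<i> * d t)) {0..t}"
    and t: "t \<in> {0..T}"
  shows "d t = 0"
proof -
  define m where "m = (\<lambda>t. exp (\<i> * \<mu> * of_real t) * d t)"
  have eq': "d t = - \<i> * integral {0..t} (\<lambda>s. \<mu> * d s)" if "t \<in> {0..T}" for t
    using integral_unique [OF eq [OF that]] by simp
  have der: "(m has_vector_derivative 0) (at t within {0..T})" if t: "t \<in> {0..T}" for t
  proof -
    have "((\<lambda>t. - \<i> * integral {0..t} (\<lambda>s. \<mu> * d s)) has_vector_derivative - \<i> * (\<mu> * d t))
        (at t within {0..T})"
      by (intro has_vector_derivative_mult_right integral_has_vector_derivative continuous_intros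
          cont t)
    then have 1: "(d has_vector_derivative - \<i> * (\<mu> * d t)) (at t within {0..T})"
      by (rule has_vector_derivative_transform [OF t, rotated]) (erule eq')
    have "((\<lambda>z. exp (\<i> * \<mu> * z)) has_field_derivative \<i> * \<mu> * exp (\<i> * \<mu> * of_real t))
        (at (of_real t))"
      by (auto intro!: derivative_eq_intros)
    then have 2: "((\<lambda>t. exp (\<i> * \<mu> * of_real t)) has_vector_derivative
        \<i> * \<mu> * exp (\<i> * \<mu> * of_real t)) (at t within {0..T})"
      using has_vector_derivative_real_field has_vector_derivative_at_within by fastforce
    show ?thesis
      using has_vector_derivative_mult [OF 2 1] by (simp add: m_def algebra_simps)
  qed
  obtain c where c: "\<And>t. t \<in> {0..T} \<Longrightarrow> m t = c"
    using has_vector_derivative_zero_constant [of "{0..T}" m] der by auto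
  have "d 0 = 0"
    using eq' [of 0] t by simp
  then show ?thesis
    using c [of 0] c [OF t] t by (simp add: m_def)
qed

text \<open>With \<open>a = (u, \<psi>)\<close> and \<open>a' = (u', \<psi>)\<close>, the primitive of \<open>a'\<close> satisfies the same scalar Volterra
  equation as \<open>a\<close>, hence equals \<open>a\<close>; evaluating the equation of \<open>a'\<close> at \<open>T\<close>, where \<open>h\<close> vanishes,
  gives the claim.\<close>

lemma weak_solution_tderiv:
  fixes h h' :: "real \<Rightarrow> 'y::chilbert_space" and u u' :: "real \<Rightarrow> 'h::chilbert_space"
  assumes T: "T > 0" and B: "bounded_clinear B"
    and u: "weak_solution D A B T h u" and u': "weak_solution D A B T h' u'"
    and deriv: "has_L2_derivative T h h'" and h0: "h 0 = 0" and hT: "h T = 0"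
    and \<psi>: "eigenvector (adj_dom D A) (adj_op D A) (cnj \<mu>) \<psi>"
  shows "cinner (u' T) \<psi> = - \<i> * \<mu> * cinner (u T) \<psi>"
proof -
  define a where "a = (\<lambda>t. cinner (u t) \<psi>)"
  define a' where "a' = (\<lambda>t. cinner (u' t) \<psi>)"
  define b where "b = (\<lambda>t. cinner (B (h t)) \<psi>)"
  define b' where "b' = (\<lambda>t. cinner (B (h' t)) \<psi>)"
  define e where "e = (\<lambda>t. integral {0..t} a')"
  have conts: "continuous_on {0..T} a" "continuous_on {0..T} a'"
    using u u' unfolding a_def a'_def weak_solution_def
    by (auto intro: bounded_bilinear.continuous_on [OF bounded_bilinear_cinner] continuous_on_const)
  have \<psi>D: "\<psi> \<in> adj_dom D A" and \<psi>A: "adj_op D A \<psi> = cnj \<mu> *\<^sub>C \<psi>"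
    using \<psi> by (auto simp: eigenvector_def)
  have eq_a: "((\<lambda>s. \<mu> * a s + b s) has_integral (\<i> * a t)) {0..t}" if "t \<in> {0..T}" for t
    using u \<psi>D that by (auto simp: weak_solution_def \<psi>A cinner_scaleC_right a_def b_def)
  have eq_a': "((\<lambda>s. \<mu> * a' s + b' s) has_integral (\<i> * a' t)) {0..t}" if "t \<in> {0..T}" for t
    using u' \<psi>D that by (auto simp: weak_solution_def \<psi>A cinner_scaleC_right a'_def b'_def)
  have lin: "bounded_linear (\<lambda>y. cinner (B y) \<psi>)"
    using bounded_linear_compose
      [OF bounded_bilinear.bounded_linear_left [OF bounded_bilinear_cinner], of B] B
    by (simp add: bounded_clinear_def)
  \<comment> \<open>The bounded functional in \<open>lin\<close> commutes with the integral;
    \<open>h 0 = 0\<close> leaves no constant of integration.\<close>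
  have int_b': "(b' has_integral b t) {0..t}" if "t \<in> {0..T}" for t
    using has_integral_linear [OF _ lin, of h' "h t" "{0..t}"] deriv that h0
    by (simp add: has_L2_derivative_def b_def b'_def o_def)
  have int_a': "(a' has_integral e t) {0..t}" if "t \<in> {0..T}" for t
    unfolding e_def using that
    by (intro integrable_integral integrable_continuous_real continuous_on_subset [OF conts(2)]) auto
  \<comment> \<open>Both sides are the integral of \<open>\<mu> * a' s + b' s\<close> over
    \<open>{0..t}\<close>: once by the weak equation, once by the primitives \<open>e\<close> and
    \<open>b\<close>.\<close>
  have a'_eq: "\<i> * a' t = \<mu> * e t + b t" if "t \<in> {0..T}" for t
    using has_integral_unique [OF eq_a' [OF that]
        has_integral_add [OF has_integral_mult_right [OF int_a' [OF that]] int_b' [OF that]]] .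
  have eq_e: "((\<lambda>s. \<mu> * e s + b s) has_integral (\<i> * e t)) {0..t}" if "t \<in> {0..T}" for t
    by (rule has_integral_eq [OF _ has_integral_mult_right [OF int_a' [OF that]]])
      (use that in \<open>auto intro: a'_eq\<close>)
  have "e T - a T = 0"
  proof (rule homogeneous_volterra_unique)
    show "continuous_on {0..T} (\<lambda>t. e t - a t)"
      unfolding e_def using conts
      by (intro continuous_on_diff indefinite_integral_continuous_1 integrable_continuous_real)
    \<comment> \<open>The forcing term \<open>b\<close> cancels in the difference, which leaves the
      homogeneous equation.\<close>
    show "((\<lambda>s. \<mu> * (e s - a s)) has_integral (\<i> * (e t - a t))) {0..t}" if "t \<in> {0..T}" for t
      using has_integral_diff [OF eq_e [OF that] eq_a [OF that]] by (simp add: algebra_simps)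
    show "T \<in> {0..T}"
      using T by simp
  qed
  moreover have "b T = 0"
    using linear_simps(3) [OF lin] hT by (simp add: b_def)
  ultimately have "\<i> * a' T = \<mu> * a T"
    using a'_eq [of T] T by simp
  then have "- \<i> * (\<i> * a' T) = - \<i> * (\<mu> * a T)"
    by simp
  then show ?thesis
    by (simp add: a_def a'_def)
qed

text \<open>\<open>control_op\<close> evaluates a chosen function at \<open>T\<close>.
  Well-posedness makes the choices for \<open>h\<close> and for its derivative genuine weak
  solutions, to which the preceding identity applies.\<close>

lemma control_op_tderiv:
  fixes h :: "real \<Rightarrow> 'y::chilbert_space" and D :: "'h::chilbert_space set"
  assumes T: "T > 0" and B: "bounded_clinear B" and wp: "well_posed D A B T" and h: "h \<in> H10 T"
    and \<psi>: "eigenvector (adj_dom D A) (adj_op D A) (cnj \<mu>) \<psi>"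
  shows "cinner (control_op D A B T (tderiv T h)) \<psi> = - \<i> * \<mu> * cinner (control_op D A B T h) \<psi>"
proof -
  have sol: "weak_solution D A B T f (SOME u. weak_solution D A B T f u)" if "f \<in> L2 T" for f
  proof -
    have "\<exists>u. weak_solution D A B T f u"
      using bspec [OF wp [unfolded well_posed_def] that] by (rule conjunct1)
    then show ?thesis
      by (rule someI_ex)
  qed
  have h': "h \<in> L2 T" "h 0 = 0" "h T = 0"
    using h by (auto simp: H10_def)
  have deriv: "has_L2_derivative T h (tderiv T h)"
    by (rule H10_tderiv [OF h])
  then have L2: "tderiv T h \<in> L2 T"
    by (simp add: has_L2_derivative_def)
  show ?thesis
    unfolding control_op_def
    by (rule weak_solution_tderiv [OF T B sol [OF h'(1)] sol [OF L2] deriv h'(2,3) \<psi>])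
qed

section \<open>The connecting operator\<close>

text \<open>Pairing the combination of controls with \<open>g k\<close> gives the coefficient of the
  final state against \<open>\<psi> k\<close>, and these vectors are total. Conversely, if the state
  is 0, the combination is orthogonal to every L2 function, itself included.\<close>

lemma connecting_operator_AE_zero_iff:
  fixes D :: "'h::chilbert_space set" and h h' :: "real \<Rightarrow> 'y::chilbert_space"
  assumes C: "connecting_operator D A B T C" and h: "h \<in> L2 T" "h' \<in> L2 T"
    and g: "\<And>k. g k \<in> L2 T" "\<And>k. dual_control_op D A B T (g k) = \<psi> k" and \<psi>: "riesz_basis \<psi>"
  shows "AE_zero T (\<lambda>t. C h' t + c *\<^sub>C C h t) \<longleftrightarrow>
    control_op D A B T h' + c *\<^sub>C control_op D A B T h = 0" (is "AE_zero T ?F \<longleftrightarrow> ?w = 0")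
proof -
  have CL: "C h \<in> L2 T" "C h' \<in> L2 T"
    using C h by (auto simp: connecting_operator_def)
  have inner: "L2_inner T ?F k = cinner ?w (dual_control_op D A B T k)" if "k \<in> L2 T" for k
    using C h that
    by (simp add: L2_inner_add_scaleC CL connecting_operator_def cinner_add_left cinner_scaleC_left)
  have "?w = 0" if "AE_zero T ?F"
    by (rule riesz_basis_total [OF \<psi>])
      (simp only: L2_inner_AE_zero [OF that] flip: g(2) inner [OF g(1)])
  moreover have "AE_zero T ?F" if w: "?w = 0"
  proof -
    have F: "?F \<in> L2 T"
      by (intro L2_add L2_scaleC CL)
    show ?thesis
      by (rule AE_zero_L2_inner_self [OF F]) (simp only: inner [OF F] w cinner_zero_left)
  qed
  ultimately show ?thesis
    by blast
qed

text \<open>Eigenvectors of the generalized problem are determined only up to a nonzero factor and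
  up to controls steering to 0. The last conjunct therefore describes them through the states they
  reach.\<close>

theorem theorem3p1:
  fixes D :: "'h::chilbert_space set" and A :: "'h \<Rightarrow> 'h"
    and B :: "'y::chilbert_space \<Rightarrow> 'h" and T :: real
    and C :: "(real \<Rightarrow> 'y) \<Rightarrow> (real \<Rightarrow> 'y)"
    and lam :: "nat \<Rightarrow> complex" and \<phi> \<psi> :: "nat \<Rightarrow> 'h"
    and f g :: "nat \<Rightarrow> real \<Rightarrow> 'y"
  assumes T: "T > 0"
    and A: "densely_defined_operator D A"
    and B: "bounded_clinear B"
    and wp: "well_posed D A B T"
    and dual_wp: "dual_well_posed D A B T"
    and C: "connecting_operator D A B T C"
    and inj_lam: "inj lam"
    and spectrum_A: "op_spectrum D A = range lam"
    and simple: "\<And>k. alg_multiplicity D A (lam k) = 1"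
    and spectrum_adj: "op_spectrum (adj_dom D A) (adj_op D A) = range (\<lambda>k. cnj (lam k))"
    and eig_A: "\<And>k. eigenvector D A (lam k) (\<phi> k)"
    and riesz_\<phi>: "riesz_basis \<phi>"
    and eig_adj: "\<And>k. eigenvector (adj_dom D A) (adj_op D A) (cnj (lam k)) (\<psi> k)"
    and riesz_\<psi>: "riesz_basis \<psi>"
    and biorth: "\<And>k l. cinner (\<phi> k) (\<psi> l) = (if k = l then 1 else 0)"
    and f_H10: "\<And>k. f k \<in> H10 T" and f_ctrl: "\<And>k. control_op D A B T (f k) = \<phi> k"
    and g_H10: "\<And>k. g k \<in> H10 T" and g_ctrl: "\<And>k. dual_control_op D A B T (g k) = \<psi> k"
  shows "gen_spectrum C T = op_spectrum D A \<and>
    (\<forall>k. gen_eigenvector C T (lam k) (f k)) \<and>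
    (\<forall>k h. gen_eigenvector C T (lam k) h \<longleftrightarrow>
       h \<in> H10 T \<and> (\<exists>c. c \<noteq> 0 \<and> control_op D A B T h = c *\<^sub>C \<phi> k))"
proof -
  let ?W = "control_op D A B T"
  have coeff: "cinner (?W (tderiv T h) + (\<i> * \<mu>) *\<^sub>C ?W h) (\<psi> l) =
      \<i> * (\<mu> - lam l) * cinner (?W h) (\<psi> l)" if "h \<in> H10 T" for h \<mu> l
    by (simp add: cinner_add_left cinner_scaleC_left control_op_tderiv [OF T B wp that eig_adj]
        algebra_simps)
  have gL: "\<And>k. g k \<in> L2 T"
    using g_H10 by (simp add: H10_def)
  have gen: "gen_eigenvector C T \<mu> h \<longleftrightarrow>
      ?W h \<noteq> 0 \<and> (\<forall>l. \<mu> = lam l \<or> cinner (?W h) (\<psi> l) = 0)" if h: "h \<in> H10 T" for h \<mu>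
  proof -
    have hL: "h \<in> L2 T" "tderiv T h \<in> L2 T"
      using h H10_tderiv [OF h] by (auto simp: H10_def has_L2_derivative_def)
    note zero_iff = connecting_operator_AE_zero_iff [OF C hL(1) _ gL g_ctrl riesz_\<psi>]
    \<comment> \<open>Taking \<open>h' = h\<close> and \<open>c = 1\<close> turns the general
      equivalence into one for twice \<open>C h\<close>, which vanishes exactly where
      \<open>C h\<close> does.\<close>
    have "AE_zero T (C h) \<longleftrightarrow> AE_zero T (\<lambda>t. C h t + 1 *\<^sub>C C h t)"
      by (simp add: AE_zero_def scaleC_one flip: scaleR_2)
    then have Ch: "AE_zero T (C h) \<longleftrightarrow> ?W h = 0"
      using zero_iff [OF hL(1), of 1] by (simp add: scaleC_one flip: scaleR_2)
    have "AE_zero T (\<lambda>t. C (tderiv T h) t + (\<i> * \<mu>) *\<^sub>C C h t) \<longleftrightarrow>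
        (\<forall>l. cinner (?W (tderiv T h) + (\<i> * \<mu>) *\<^sub>C ?W h) (\<psi> l) = 0)"
      unfolding zero_iff [OF hL(2)] using riesz_basis_total [OF riesz_\<psi>] by (metis cinner_zero_left)
    then show ?thesis
      using h by (simp add: gen_eigenvector_def Ch coeff)
  qed
  have \<phi>0: "\<phi> k \<noteq> 0" for k
    using eig_A by (simp add: eigenvector_def)
  have char: "gen_eigenvector C T (lam k) h \<longleftrightarrow>
      h \<in> H10 T \<and> (\<exists>c. c \<noteq> 0 \<and> ?W h = c *\<^sub>C \<phi> k)" for k h
  proof (intro iffI conjI)
    assume e: "gen_eigenvector C T (lam k) h"
    then show h: "h \<in> H10 T"
      by (simp add: gen_eigenvector_def)
    \<comment> \<open>The only coefficient of \<open>?W h\<close> that can survive: for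
      \<open>l \<noteq> k\<close>, injectivity of \<open>lam\<close> rules out
      \<open>lam k = lam l\<close>, so \<open>gen\<close> forces the coefficient at \<open>l\<close>
      to be 0.\<close>
    define c where "c = cinner (?W h) (\<psi> k)"
    have "cinner (?W h - c *\<^sub>C \<phi> k) (\<psi> l) = 0" for l
      using e inj_lam
      by (cases "k = l") (auto simp: gen [OF h] cinner_diff_left cinner_scaleC_left biorth c_def inj_eq)
    then have "?W h - c *\<^sub>C \<phi> k = 0"
      by (rule riesz_basis_total [OF riesz_\<psi>])
    moreover have "?W h \<noteq> 0"
      using e by (simp add: gen [OF h])
    ultimately show "\<exists>c. c \<noteq> 0 \<and> ?W h = c *\<^sub>C \<phi> k"
      by (intro exI [of _ c]) auto
  next
    assume "h \<in> H10 T \<and> (\<exists>c. c \<noteq> 0 \<and> ?W h = c *\<^sub>C \<phi> k)"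
    \<comment> \<open>By biorthogonality the only nonzero coefficient of the state is the one at
      \<open>k\<close>, where the two eigenvalues agree.\<close>
    then show "gen_eigenvector C T (lam k) h"
      using \<phi>0 by (auto simp: gen cinner_scaleC_left biorth split: if_splits)
  qed
  have eig_f: "gen_eigenvector C T (lam k) (f k)" for k
    unfolding char using f_H10 by (auto simp: f_ctrl scaleC_one intro: exI [of _ 1])
  \<comment> \<open>If \<open>\<mu>\<close> differed from every \<open>lam l\<close>, all
    coefficients of \<open>?W h\<close> would vanish, and totality would give
    \<open>?W h = 0\<close>, which \<open>gen\<close> excludes.\<close>
  have "\<mu> \<in> range lam" if "gen_eigenvector C T \<mu> h" for \<mu> h
    using that gen [of h \<mu>] riesz_basis_total [OF riesz_\<psi>, of "?W h"]
    by (auto simp: gen_eigenvector_def)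
  then have "gen_spectrum C T = range lam"
    using eig_f by (auto simp: gen_spectrum_def)
  then show ?thesis
    using eig_f char spectrum_A by simp
qed

end
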